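(* Let $(X,d_X)$ be a Polish metric space, $\xi$ a Borel probability measure on $X$ with finite second moment with respect to $d_X$, and let $\mathbb{X}=(X,g,\xi)$ be a gm-space with $g=\varphi\circ d_X$, where $\varphi:[0,\infty)\to\mathbb{R}$. Let $n\in\mathbb{N}$, $n\ge1$, and let $\mathrm{q}_n^{\mathrm W}(\xi)$ be the Wasserstein quantization value with respect to the metric $d_X$. If $\varphi$ is $L$-Lipschitz continuous on the range of $d_X$, then $$\mathrm{q}_n^{\mathrm{GW}}(\mathbb{X})\le 2L\,\mathrm{q}_n^{\mathrm W}(\xi).$$
   Context: A gauged measure space (gm-space) is a triple $(X,g,\xi)$ where $X$ is a Polish space, $\xi$ is a Borel probability measure on $X$, and the gauge $g\in L^2(X\times X,\xi\otimes\xi)$ is symmetric. For gm-spaces $\mathbb{X}=(X,g,\xi)$ and $\mathbb{Y}=(Y,h,\upsilon)$, with $\Pi(\xi,\upsilon)$ the set of couplings of $\xi$ and $\upsilon$, $$\mathrm{GW}_2(\mathbb{X},\mathbb{Y})=\inf_{\pi\in\Pi(\xi,\upsilon)}\Big(\iint_{(X\times Y)^2}|g(x,x')-h(y,y')|^2\,\mathrm{d}\pi(x,y)\,\mathrm{d}\pi(x',y')\Big)^{1/2}.$$ Write $[n]=\{1,\dots,n\}$. $\mathfrak{GM}_n$ is the set of gm-spaces $([n],G,\upsilon)$ with $G\in\mathbb{R}^{n\times n}$ symmetric (viewed as the gauge $(i,i')\mapsto G_{i,i'}$) and $\upsilon$ a probability measure on $[n]$; $\mathrm{q}_n^{\mathrm{GW}}(\mathbb{X}):=\inf_{\mathbb{Y}\in\mathfrak{GM}_n}\mathrm{GW}_2(\mathbb{X},\mathbb{Y})$.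 $\mathcal{P}_n(X)=\{\sum_{i=1}^n\upsilon_i\delta_{y_i}:y_i\in X,\ \upsilon_i\ge0,\ \sum_i\upsilon_i=1\}$, $\mathrm{W}_2(\xi,\upsilon)=\inf_{\pi\in\Pi(\xi,\upsilon)}\big(\int d_X^2(x,y)\,\mathrm{d}\pi(x,y)\big)^{1/2}$, and $\mathrm{q}_n^{\mathrm W}(\xi):=\inf_{\upsilon\in\mathcal{P}_n(X)}\mathrm{W}_2(\xi,\upsilon)$. *)

theory Defs
  imports "HOL-Probability.Probability"
begin

text \<open>
  A gauged measure space is a triple of a topological space, a gauge and a measure. The underlying
  set is the \<open>topspace\<close> of the topology, so that both a Polish space given by a type and the
  discrete space \<open>{1..n}\<close> are instances.
\<close>

type_synonym 'a gm = "'a topology \<times> ('a \<Rightarrow> 'a \<Rightarrow> real) \<times> 'a measure"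

text \<open>
  The gauge is a representative of an \<open>L\<^sup>2\<close> class, hence its symmetry is required almost everywhere.
  Since the topology is second countable, the product \<open>\<sigma>\<close>-algebra of \<open>\<xi> \<Otimes>\<^sub>M \<xi>\<close> is the Borel
  \<open>\<sigma>\<close>-algebra of the product space.
\<close>

fun gm_space :: "'a gm \<Rightarrow> bool" where
  "gm_space (X, g, \<xi>) \<longleftrightarrow>
     completely_metrizable_space X \<and> second_countable X \<and>
     sets \<xi> = sets (sigma (topspace X) {U. openin X U}) \<and> prob_space \<xi> \<and>
     (\<lambda>(x, x'). g x x') \<in> borel_measurable (\<xi> \<Otimes>\<^sub>M \<xi>) \<and>
     integrable (\<xi> \<Otimes>\<^sub>M \<xi>) (\<lambda>(x, x'). (g x x')\<^sup>2) \<and>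
     (AE (x, x') in \<xi> \<Otimes>\<^sub>M \<xi>. g x x' = g x' x)"

definition couplings :: "'a measure \<Rightarrow> 'b measure \<Rightarrow> ('a \<times> 'b) measure set" where
  "couplings \<xi> \<upsilon> =
     {\<pi>. sets \<pi> = sets (\<xi> \<Otimes>\<^sub>M \<upsilon>) \<and> distr \<pi> \<xi> fst = \<xi> \<and> distr \<pi> \<upsilon> snd = \<upsilon>}"

text \<open>
  The transport costs take values in \<open>[0, \<infinity>]\<close>, so that no integral or infimum has an
  arbitrary default value.
\<close>

definition ennreal_sqrt :: "ennreal \<Rightarrow> ennreal" where
  "ennreal_sqrt a = (if a = \<infinity> then \<infinity> else ennreal (sqrt (enn2real a)))"

fun GW2 :: "'a gm \<Rightarrow> 'b gm \<Rightarrow> ennreal" where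
  "GW2 (X, g, \<xi>) (Y, h, \<upsilon>) =
     (INF \<pi>\<in>couplings \<xi> \<upsilon>. ennreal_sqrt
       (\<integral>\<^sup>+ ((x, y), (x', y')). ennreal (\<bar>g x x' - h y y'\<bar>\<^sup>2) \<partial>(\<pi> \<Otimes>\<^sub>M \<pi>)))"

text \<open>Only the entries of \<open>G\<close> with indices in \<open>{1..n}\<close> matter.\<close>

definition GM :: "nat \<Rightarrow> nat gm set" where
  "GM n = {(discrete_topology {1..n}, G, \<upsilon>) | G \<upsilon>.
     (\<forall>i\<in>{1..n}. \<forall>j\<in>{1..n}. G i j = G j i) \<and> gm_space (discrete_topology {1..n}, G, \<upsilon>)}"

definition q_GW :: "nat \<Rightarrow> 'a gm \<Rightarrow> ennreal" where
  "q_GW n \<X> = (INF \<Y>\<in>GM n. GW2 \<X> \<Y>)"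

definition finitely_supported :: "nat \<Rightarrow> 'a::topological_space measure set" where
  "finitely_supported n = {\<upsilon>. sets \<upsilon> = sets borel \<and>
     (\<exists>(y :: nat \<Rightarrow> 'a) (w :: nat \<Rightarrow> real).
        (\<forall>i\<in>{1..n}. 0 \<le> w i) \<and> (\<Sum>i=1..n. w i) = 1 \<and>
        (\<forall>A\<in>sets borel.
           emeasure \<upsilon> A = (\<Sum>i=1..n. ennreal (w i) * emeasure (return borel (y i)) A)))}"

definition W2 :: "'a::metric_space measure \<Rightarrow> 'a measure \<Rightarrow> ennreal" where
  "W2 \<xi> \<upsilon> =
     (INF \<pi>\<in>couplings \<xi> \<upsilon>. ennreal_sqrt (\<integral>\<^sup>+ (x, y). ennreal ((dist x y)\<^sup>2) \<partial>\<pi>))"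

definition q_W :: "nat \<Rightarrow> 'a::metric_space measure \<Rightarrow> ennreal" where
  "q_W n \<xi> = (INF \<upsilon>\<in>finitely_supported n. W2 \<xi> \<upsilon>)"

definition finite_second_moment :: "'a::metric_space measure \<Rightarrow> bool" where
  "finite_second_moment \<xi> \<longleftrightarrow> (\<exists>x\<^sub>0. (\<integral>\<^sup>+ x. ennreal ((dist x\<^sub>0 x)\<^sup>2) \<partial>\<xi>) < \<infinity>)"

end

theory Submission
  imports Defs
begin

text \<open>
  A quantizer of \<open>\<xi>\<close> in the Wasserstein sense also quantizes the gauged space, with the gauge
  evaluated at its atoms. Let \<open>\<upsilon>\<close> be carried by \<open>y 1, \<dots>, y n\<close> and let \<open>\<pi>\<close> couple \<open>\<xi>\<close> with \<open>\<upsilon>\<close>.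
  Replacing the second coordinate of \<open>\<pi>\<close> by the index of the atom there gives a coupling \<open>\<pi>'\<close> of
  \<open>\<xi>\<close> with a measure on \<open>{1..n}\<close>, and on \<open>{1..n}\<close> the gauge is \<open>G i j = \<phi> (dist (y i) (y j))\<close>.
  The triangle inequality bounds \<open>\<bar>dist x x' - dist z z'\<bar>\<close> by \<open>dist x z + dist x' z'\<close>, so the
  distortion of the gauges is at most \<open>L * (dist x z + dist x' z')\<close>, where \<open>z\<close> and \<open>z'\<close> are the
  atoms. Squaring, \<open>(a + b)\<^sup>2 \<le> 2 * a\<^sup>2 + 2 * b\<^sup>2\<close> and the fact that \<open>\<pi>\<close> has mass one turn the double
  integral into \<open>4 * L\<^sup>2\<close> times the transport cost of \<open>\<pi>\<close>. The root of that factor is the constant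
  \<open>2 * L\<close>. This is \<open>q_GW_le_coupling_cost\<close>.

  It remains to take the infimum over \<open>\<pi>\<close> and then over \<open>\<upsilon>\<close>. A factor moves through an infimum
  in \<open>[0, \<infinity>]\<close> only with care: for \<open>L = 0\<close> an infimum over the empty set would give
  \<open>0 * \<infinity> = 0\<close>, a bound with nothing behind it. Hence one needs that there are
  quantizers and couplings at all (\<open>finitely_supported_nonempty\<close>, \<open>pair_measure_in_couplings\<close>).
\<close>

section \<open>Infima and square roots in the extended nonnegative reals\<close>

lemma le_mult_INF_ennreal:
  fixes a c :: ennreal
  assumes "I \<noteq> {}" "c \<noteq> \<top>" and le: "\<And>i. i \<in> I \<Longrightarrow> a \<le> c * f i"
  shows "a \<le> c * (INF i\<in>I. f i)"
proof (cases "c = 0")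
  case True
  then show ?thesis using assms by auto
next
  case False
  then have "a / c \<le> (INF i\<in>I. f i)"
    using le by (intro INF_greatest divide_le_posI_ennreal) (auto simp: zero_less_iff_neq_zero)
  then have "c * (a / c) \<le> c * (INF i\<in>I. f i)"
    by (rule mult_left_mono) simp
  then show ?thesis
    using False assms(2)
    by (simp add: ennreal_times_divide mult.commute[of c a] ennreal_mult_divide_eq)
qed

lemma ennreal_sqrt_mono: "a \<le> b \<Longrightarrow> ennreal_sqrt a \<le> ennreal_sqrt b"
  by (auto simp: ennreal_sqrt_def top_unique less_top intro!: ennreal_leI enn2real_mono)

text \<open>
  Also true if \<open>a = \<infinity>\<close> and \<open>c = 0\<close>, as then both sides vanish; this lets the main estimate treat
  couplings of infinite cost and \<open>L = 0\<close> without a case distinction.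
\<close>

lemma ennreal_sqrt_mult_square:
  assumes "0 \<le> c"
  shows "ennreal_sqrt (ennreal (c\<^sup>2) * a) = ennreal c * ennreal_sqrt a"
proof (cases "a = \<top>")
  case True
  then show ?thesis
    using assms by (cases "c = 0") (auto simp: ennreal_sqrt_def ennreal_mult_top)
next
  case False
  then show ?thesis
    using assms
    by (auto simp: ennreal_sqrt_def ennreal_mult_eq_top_iff enn2real_mult real_sqrt_mult ennreal_mult)
qed

section \<open>Couplings\<close>

lemma prob_space_coupling:
  assumes "prob_space \<xi>" "\<pi> \<in> couplings \<xi> \<upsilon>"
  shows "prob_space \<pi>"
proof -
  have s: "sets \<pi> = sets (\<xi> \<Otimes>\<^sub>M \<upsilon>)" and d: "distr \<pi> \<xi> fst = \<xi>"
    using assms by (auto simp: couplings_def)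
  have "fst \<in> \<pi> \<rightarrow>\<^sub>M \<xi>"
    using s by (simp cong: measurable_cong_sets)
  then show ?thesis
    using assms(1) d prob_space_distrD by metis
qed

lemma pair_measure_in_couplings:
  assumes "prob_space \<xi>" "prob_space \<upsilon>"
  shows "\<xi> \<Otimes>\<^sub>M \<upsilon> \<in> couplings \<xi> \<upsilon>"
proof -
  interpret X: prob_space \<xi> by fact
  interpret Y: prob_space \<upsilon> by fact
  interpret pair_prob_space \<xi> \<upsilon> ..
  interpret S: pair_prob_space \<upsilon> \<xi> ..
  have "distr (\<xi> \<Otimes>\<^sub>M \<upsilon>) \<upsilon> snd = distr (\<upsilon> \<Otimes>\<^sub>M \<xi>) \<upsilon> fst"
    by (subst distr_pair_swap) (simp add: distr_distr comp_def case_prod_unfold)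
  then show ?thesis
    by (simp add: couplings_def X.distr_pair_fst Y.distr_pair_fst)
qed

lemma couplings_distr_snd:
  assumes \<pi>: "\<pi> \<in> couplings \<xi> \<upsilon>" and T: "T \<in> \<upsilon> \<rightarrow>\<^sub>M N"
  shows "distr \<pi> (\<xi> \<Otimes>\<^sub>M N) (\<lambda>(x, v). (x, T v)) \<in> couplings \<xi> (distr \<upsilon> N T)"
proof -
  have s[measurable_cong]: "sets \<pi> = sets (\<xi> \<Otimes>\<^sub>M \<upsilon>)"
    and d: "distr \<pi> \<xi> fst = \<xi>" "distr \<pi> \<upsilon> snd = \<upsilon>"
    using \<pi> by (auto simp: couplings_def)
  note T[measurable]
  have "distr \<pi> N (\<lambda>p. T (snd p)) = distr (distr \<pi> \<upsilon> snd) N T"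
    by (subst distr_distr) (auto simp: comp_def)
  also have "\<dots> = distr \<upsilon> N T" by (simp add: d)
  also have "\<dots> = distr \<upsilon> (distr \<upsilon> N T) T" by (rule distr_cong) simp_all
  finally have *: "distr \<pi> (distr \<upsilon> N T) (\<lambda>p. T (snd p)) = distr \<upsilon> N T"
    by (metis distr_cong sets_distr)
  have "distr (distr \<pi> (\<xi> \<Otimes>\<^sub>M N) (\<lambda>(x, v). (x, T v))) \<xi> fst = distr \<pi> \<xi> fst"
    by (subst distr_distr) (auto simp: comp_def case_prod_unfold)
  moreover have "distr (distr \<pi> (\<xi> \<Otimes>\<^sub>M N) (\<lambda>(x, v). (x, T v))) (distr \<upsilon> N T) snd
      = distr \<pi> (distr \<upsilon> N T) (\<lambda>p. T (snd p))"
    by (subst distr_distr) (auto simp: comp_def case_prod_unfold)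
  moreover have "sets (\<xi> \<Otimes>\<^sub>M N) = sets (\<xi> \<Otimes>\<^sub>M distr \<upsilon> N T)"
    by (rule sets_pair_measure_cong) simp_all
  ultimately show ?thesis
    using d * by (simp add: couplings_def)
qed

text \<open>
  The elementary bound \<open>(a + b)\<^sup>2 \<le> 2 * a\<^sup>2 + 2 * b\<^sup>2\<close> gives the same constant as Minkowski's inequality
  here, because the two summands have equal norm.
\<close>

lemma nn_integral_pair_sum_square_le:
  fixes a :: "'c \<Rightarrow> real"
  assumes "prob_space \<pi>" and [measurable]: "a \<in> borel_measurable \<pi>"
  shows "(\<integral>\<^sup>+ (p, q). ennreal ((a p + a q)\<^sup>2) \<partial>(\<pi> \<Otimes>\<^sub>M \<pi>)) \<le> 4 * (\<integral>\<^sup>+ p. ennreal ((a p)\<^sup>2) \<partial>\<pi>)"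
proof -
  interpret prob_space \<pi> by fact
  have "ennreal ((a p + a q)\<^sup>2) \<le> 2 * ennreal ((a p)\<^sup>2) + 2 * ennreal ((a q)\<^sup>2)" for p q
  proof -
    have "(a p + a q)\<^sup>2 \<le> 2 * (a p)\<^sup>2 + 2 * (a q)\<^sup>2"
      using zero_le_power2[of "a p - a q"] by (simp add: power2_sum power2_diff)
    then have "ennreal ((a p + a q)\<^sup>2) \<le> ennreal (2 * (a p)\<^sup>2 + 2 * (a q)\<^sup>2)"
      by (rule ennreal_leI)
    then show ?thesis
      by (simp add: ennreal_mult)
  qed
  then have "(\<integral>\<^sup>+ (p, q). ennreal ((a p + a q)\<^sup>2) \<partial>(\<pi> \<Otimes>\<^sub>M \<pi>))
      \<le> (\<integral>\<^sup>+ (p, q). 2 * ennreal ((a p)\<^sup>2) + 2 * ennreal ((a q)\<^sup>2) \<partial>(\<pi> \<Otimes>\<^sub>M \<pi>))"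
    by (intro nn_integral_mono) auto
  also have "\<dots> = (\<integral>\<^sup>+ p. \<integral>\<^sup>+ q. 2 * ennreal ((a p)\<^sup>2) + 2 * ennreal ((a q)\<^sup>2) \<partial>\<pi> \<partial>\<pi>)"
    by (subst nn_integral_fst[symmetric]) auto
  also have "\<dots> = 2 * (\<integral>\<^sup>+ p. ennreal ((a p)\<^sup>2) \<partial>\<pi>) + 2 * (\<integral>\<^sup>+ p. ennreal ((a p)\<^sup>2) \<partial>\<pi>)"
    by (simp add: nn_integral_add nn_integral_cmult emeasure_space_1)
  also have "\<dots> = 4 * (\<integral>\<^sup>+ p. ennreal ((a p)\<^sup>2) \<partial>\<pi>)"
    by (simp flip: distrib_right)
  finally show ?thesis .
qed

section \<open>Finite spaces and finitely supported measures\<close>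

text \<open>
  The analytic requirements on a gm-space are automatic on a finite set, where every function is
  measurable and bounded.
\<close>

lemma discrete_gm_in_GM:
  assumes "prob_space \<upsilon>" and sets: "sets \<upsilon> = Pow {1..n}"
    and sym: "\<And>i j. i \<in> {1..n} \<Longrightarrow> j \<in> {1..n} \<Longrightarrow> G i j = G j i"
  shows "(discrete_topology {1..n}, G, \<upsilon>) \<in> GM n"
proof -
  interpret prob_space \<upsilon> by fact
  interpret P: pair_prob_space \<upsilon> \<upsilon> ..
  have sp: "space \<upsilon> = {1..n}" using sets_eq_imp_space_eq[of \<upsilon> "count_space {1..n}"] sets by simp
  have "sets (\<upsilon> \<Otimes>\<^sub>M \<upsilon>) = sets (count_space {1..n} \<Otimes>\<^sub>M count_space {1..n})"
    by (rule sets_pair_measure_cong) (simp_all add: sets)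
  also have "\<dots> = sets (count_space ({1..n} \<times> {1..n}))"
    by (subst pair_measure_countable) auto
  finally have s2: "sets (\<upsilon> \<Otimes>\<^sub>M \<upsilon>) = sets (count_space ({1..n} \<times> {1..n}))" .
  have meas: "f \<in> borel_measurable (\<upsilon> \<Otimes>\<^sub>M \<upsilon>)" for f :: "nat \<times> nat \<Rightarrow> real"
    by (simp cong: measurable_cong_sets add: measurable_cong_sets[OF s2 refl])
  have "integrable (\<upsilon> \<Otimes>\<^sub>M \<upsilon>) (\<lambda>(i, j). (G i j)\<^sup>2)"
  proof (rule P.integrable_const_bound[OF _ meas])
    show "AE p in \<upsilon> \<Otimes>\<^sub>M \<upsilon>. norm (case p of (i, j) \<Rightarrow> (G i j)\<^sup>2)
            \<le> Max ((\<lambda>(i, j). (G i j)\<^sup>2) ` ({1..n} \<times> {1..n}))"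
    proof (rule AE_I2)
      fix p assume "p \<in> space (\<upsilon> \<Otimes>\<^sub>M \<upsilon>)"
      then have "p \<in> {1..n} \<times> {1..n}"
        by (simp add: space_pair_measure sp)
      then have "(case p of (i, j) \<Rightarrow> (G i j)\<^sup>2) \<le> Max ((\<lambda>(i, j). (G i j)\<^sup>2) ` ({1..n} \<times> {1..n}))"
        by (intro Max_ge finite_imageI finite_SigmaI imageI) auto
      then show "norm (case p of (i, j) \<Rightarrow> (G i j)\<^sup>2)
            \<le> Max ((\<lambda>(i, j). (G i j)\<^sup>2) ` ({1..n} \<times> {1..n}))"
        by (simp add: case_prod_unfold)
    qed
  qed
  moreover have "AE (i, j) in \<upsilon> \<Otimes>\<^sub>M \<upsilon>. G i j = G j i"
    by (rule AE_I2) (auto simp: space_pair_measure sp intro!: sym)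
  moreover have "sets \<upsilon> = sets (sigma {1..n} (Collect (openin (discrete_topology {1..n}))))"
  proof -
    have "Collect (openin (discrete_topology {1..n})) = Pow {1..n}"
      by (simp add: set_eq_iff)
    then show ?thesis
      by (simp add: sets sigma_algebra.sigma_sets_eq[OF sigma_algebra_Pow])
  qed
  ultimately have "gm_space (discrete_topology {1..n}, G, \<upsilon>)"
    using assms(1) by (simp add: completely_metrizable_space_discrete_topology meas
        second_countable_discrete_topology countable_finite del: sets_measure_of)
  with sym show ?thesis
    by (auto simp: GM_def)
qed

lemma finitely_supportedE:
  fixes \<upsilon> :: "'a::t1_space measure"
  assumes "\<upsilon> \<in> finitely_supported n"
  obtains y :: "nat \<Rightarrow> 'a" where "sets \<upsilon> = sets borel" "prob_space \<upsilon>" "AE v in \<upsilon>. v \<in> y ` {1..n}"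
proof -
  obtain y :: "nat \<Rightarrow> 'a" and w :: "nat \<Rightarrow> real" where s: "sets \<upsilon> = sets borel"
    and w: "\<And>i. i\<in>{1..n} \<Longrightarrow> 0 \<le> w i" "(\<Sum>i=1..n. w i) = 1"
    and em: "\<And>A. A\<in>sets borel \<Longrightarrow>
           emeasure \<upsilon> A = (\<Sum>i=1..n. ennreal (w i) * emeasure (return borel (y i)) A)"
    using assms unfolding finitely_supported_def by blast
  have B: "y ` {1..n} \<in> sets borel"
    by (intro borel_closed finite_imp_closed) simp
  have full: "emeasure \<upsilon> A = 1" if "A \<in> sets borel" "y ` {1..n} \<subseteq> A" for A
  proof -
    have "emeasure \<upsilon> A = (\<Sum>i=1..n. ennreal (w i))"
      using that by (subst em) (auto intro!: sum.cong)
    then show ?thesis using w by (subst (asm) sum_ennreal) auto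
  qed
  have p: "prob_space \<upsilon>"
    using full[of UNIV] sets_eq_imp_space_eq[OF s] by (intro prob_spaceI) simp
  interpret prob_space \<upsilon> by fact
  have "prob (y ` {1..n}) = 1"
    using full[OF B order_refl] by (simp add: measure_def)
  then have "AE v in \<upsilon>. v \<in> y ` {1..n}"
    using B s prob_eq_1 by metis
  with s p show ?thesis by (rule that)
qed

lemma finitely_supported_nonempty:
  assumes "n \<ge> 1"
  shows "(finitely_supported n :: 'a::topological_space measure set) \<noteq> {}"
proof -
  fix a :: 'a
  have "return borel a \<in> finitely_supported n"
    using assms unfolding finitely_supported_def
    by (auto intro!: exI[of _ "\<lambda>_. a"] exI[of _ "\<lambda>i. if i = 1 then 1 else 0"]
        simp: if_distrib[of ennreal] if_distrib[of "\<lambda>c. c * _"] cong: if_cong)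
  then show ?thesis by blast
qed

text \<open>
  The atoms may be repeated, so an index has to be chosen for each. The choice is measurable because
  finite sets are closed; points off the atoms get the index 1, which lies in \<open>{1..n}\<close> as \<open>n \<ge> 1\<close>.
\<close>

lemma measurable_atom_index:
  fixes y :: "nat \<Rightarrow> 'a::t1_space"
  assumes "n \<ge> 1"
  obtains T where "T \<in> borel \<rightarrow>\<^sub>M count_space {1..n}" "\<And>v. v \<in> y ` {1..n} \<Longrightarrow> y (T v) = v"
proof
  let ?S = "y ` {1..n}"
  let ?T = "\<lambda>v. if v \<in> ?S then inv_into {1..n} y v else 1"
  have fin: "A \<in> sets borel" if "A \<subseteq> ?S" for A
    using that finite_subset[OF that] by (intro borel_closed finite_imp_closed) simp
  show "?T \<in> borel \<rightarrow>\<^sub>M count_space {1..n}"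
  proof (subst measurable_count_space_eq2, simp, intro conjI ballI)
    show "?T \<in> space borel \<rightarrow> {1..n}"
      using assms inv_into_into[of _ y "{1..n}"] by auto
    fix a
    have "?T -` {a} \<inter> space borel = {v \<in> ?S. inv_into {1..n} y v = a} \<union> (if a = 1 then - ?S else {})"
      by (auto split: if_splits)
    also have "\<dots> \<in> sets borel"
      using fin[of ?S] fin[of "{v \<in> ?S. inv_into {1..n} y v = a}"] by auto
    finally show "?T -` {a} \<inter> space borel \<in> sets borel" .
  qed
  show "y (?T v) = v" if "v \<in> ?S" for v
    using that f_inv_into_f[of v y "{1..n}"] by simp
qed

section \<open>Comparison of the two quantization values\<close>

lemma lipschitz_dist_diff_le:
  fixes x x' z z' :: "'a::metric_space"
  assumes "L-lipschitz_on (range (\<lambda>(x :: 'a, x' :: 'a). dist x x')) \<phi>"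
  shows "\<bar>\<phi> (dist x x') - \<phi> (dist z z')\<bar> \<le> L * (dist x z + dist x' z')"
proof -
  have "dist a b \<in> range (\<lambda>(x :: 'a, x' :: 'a). dist x x')" for a b :: 'a
    by (rule range_eqI[of _ _ "(a, b)"]) simp
  then have "\<bar>\<phi> (dist x x') - \<phi> (dist z z')\<bar> \<le> L * \<bar>dist x x' - dist z z'\<bar>"
    using lipschitz_onD[OF assms, of "dist x x'" "dist z z'"] by (simp add: dist_real_def)
  also have "\<bar>dist x x' - dist z z'\<bar> \<le> dist x z + dist x' z'"
    using dist_triangle[of x x' z] dist_triangle[of z x' z'] dist_triangle[of z z' x]
      dist_triangle[of x z' x'] by (simp add: dist_commute)
  then have "L * \<bar>dist x x' - dist z z'\<bar> \<le> L * (dist x z + dist x' z')"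
    using lipschitz_on_nonneg[OF assms] by (rule mult_left_mono)
  finally show ?thesis .
qed

lemma q_GW_le_coupling_cost:
  fixes \<xi> :: "'a::polish_space measure"
  assumes \<xi>: "sets \<xi> = sets borel" "prob_space \<xi>"
    and g: "(\<lambda>(x, x'). \<phi> (dist x x')) \<in> borel_measurable (\<xi> \<Otimes>\<^sub>M \<xi>)"
    and n: "n \<ge> 1"
    and lip: "L-lipschitz_on (range (\<lambda>(x :: 'a, x' :: 'a). dist x x')) \<phi>"
    and \<upsilon>: "\<upsilon> \<in> finitely_supported n" and \<pi>: "\<pi> \<in> couplings \<xi> \<upsilon>"
  shows "q_GW n (X, \<lambda>x x'. \<phi> (dist x x'), \<xi>)
    \<le> 2 * ennreal L * ennreal_sqrt (\<integral>\<^sup>+ (x, v). ennreal ((dist x v)\<^sup>2) \<partial>\<pi>)"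
proof -
  let ?N = "count_space {1..n}"
  obtain y :: "nat \<Rightarrow> 'a" where s\<upsilon>: "sets \<upsilon> = sets borel" and p\<upsilon>: "prob_space \<upsilon>"
    and supp: "AE v in \<upsilon>. v \<in> y ` {1..n}"
    using finitely_supportedE[OF \<upsilon>] by blast
  obtain T where T: "T \<in> borel \<rightarrow>\<^sub>M ?N" and yT: "\<And>v. v \<in> y ` {1..n} \<Longrightarrow> y (T v) = v"
    using measurable_atom_index[OF n] by blast
  have T\<upsilon>[measurable]: "T \<in> \<upsilon> \<rightarrow>\<^sub>M ?N"
    using T measurable_cong_sets[OF s\<upsilon> refl] by blast
  have L: "0 \<le> L" using lip by (rule lipschitz_on_nonneg)
  have s\<pi>[measurable_cong]: "sets \<pi> = sets (\<xi> \<Otimes>\<^sub>M \<upsilon>)" and snd\<pi>: "distr \<pi> \<upsilon> snd = \<upsilon>"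
    using \<pi> by (auto simp: couplings_def)
  note \<xi>(1)[measurable_cong] s\<upsilon>[measurable_cong] g[measurable]
  interpret \<pi>: prob_space \<pi> using prob_space_coupling \<xi>(2) \<pi> .
  \<comment> \<open>The atom \<open>y (T v)\<close> enters the cost \<open>a\<close> in place of \<open>v\<close>. This makes the pointwise bound hold
    everywhere, so that the null set off the atoms matters only for \<open>\<pi>\<close>, not for \<open>\<pi> \<Otimes>\<^sub>M \<pi>\<close>.\<close>
  define G where "G i j = \<phi> (dist (y i) (y j))" for i j
  define \<upsilon>' where "\<upsilon>' = distr \<upsilon> ?N T"
  define F where "F = (\<lambda>(x :: 'a, v). (x, T v))"
  define \<pi>' where "\<pi>' = distr \<pi> (\<xi> \<Otimes>\<^sub>M ?N) F"
  define a where "a = (\<lambda>(x, v). dist x (y (T v)))"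
  define c where "c = (\<lambda>((x :: 'a, i), (x' :: 'a, i')). ennreal (\<bar>\<phi> (dist x x') - G i i'\<bar>\<^sup>2))"
  have F[measurable]: "F \<in> \<pi> \<rightarrow>\<^sub>M \<xi> \<Otimes>\<^sub>M ?N" unfolding F_def by measurable
  have "(\<lambda>v. y (T v)) \<in> borel_measurable \<upsilon>"
    using measurable_compose[OF T\<upsilon>, of y borel] by simp
  then have a[measurable]: "a \<in> borel_measurable \<pi>"
    unfolding a_def by measurable
  have "?N \<Otimes>\<^sub>M ?N = count_space ({1..n} \<times> {1..n})"
    by (rule pair_measure_countable) auto
  then have Gm: "(\<lambda>(i, j). G i j) \<in> borel_measurable (?N \<Otimes>\<^sub>M ?N)" by simp
  have c: "c \<in> borel_measurable ((\<xi> \<Otimes>\<^sub>M ?N) \<Otimes>\<^sub>M (\<xi> \<Otimes>\<^sub>M ?N))"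
  proof -
    have "(\<lambda>p. \<phi> (dist (fst (fst p)) (fst (snd p))))
        \<in> borel_measurable ((\<xi> \<Otimes>\<^sub>M ?N) \<Otimes>\<^sub>M (\<xi> \<Otimes>\<^sub>M ?N))"
      using measurable_compose[OF _ g, of "\<lambda>p. (fst (fst p), fst (snd p))"] by simp
    moreover have "(\<lambda>p. G (snd (fst p)) (snd (snd p)))
        \<in> borel_measurable ((\<xi> \<Otimes>\<^sub>M ?N) \<Otimes>\<^sub>M (\<xi> \<Otimes>\<^sub>M ?N))"
    proof -
      have "(\<lambda>p. (snd (fst p), snd (snd p)))
          \<in> ((\<xi> \<Otimes>\<^sub>M ?N) \<Otimes>\<^sub>M (\<xi> \<Otimes>\<^sub>M ?N)) \<rightarrow>\<^sub>M (?N \<Otimes>\<^sub>M ?N)"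
        by measurable
      from measurable_compose[OF this Gm] show ?thesis
        by (simp only: prod.case)
    qed
    ultimately show ?thesis
      unfolding c_def case_prod_unfold by measurable
  qed
  have GM: "(discrete_topology {1..n}, G, \<upsilon>') \<in> GM n"
    using prob_space.prob_space_distr[OF p\<upsilon> T\<upsilon>]
    by (intro discrete_gm_in_GM) (auto simp: \<upsilon>'_def G_def dist_commute)
  have \<pi>': "\<pi>' \<in> couplings \<xi> \<upsilon>'"
    using couplings_distr_snd[OF \<pi> T\<upsilon>] by (simp add: \<pi>'_def \<upsilon>'_def F_def)
  have "AE p in distr \<pi> \<upsilon> snd. p \<in> y ` {1..n}" using supp by (simp only: snd\<pi>)
  then have "AE p in \<pi>. snd p \<in> y ` {1..n}"
    by (rule AE_distrD[rotated]) measurable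
  then have ae: "AE p in \<pi>. a p = dist (fst p) (snd p)"
    by eventually_elim (simp add: a_def case_prod_unfold yT)
  have "(\<integral>\<^sup>+ p. c p \<partial>(\<pi>' \<Otimes>\<^sub>M \<pi>')) = (\<integral>\<^sup>+ (p, q). c (F p, F q) \<partial>(\<pi> \<Otimes>\<^sub>M \<pi>))"
  proof -
    have "sigma_finite_measure \<pi>'"
      unfolding \<pi>'_def by (intro prob_space_imp_sigma_finite \<pi>.prob_space_distr F)
    then have "\<pi>' \<Otimes>\<^sub>M \<pi>' = distr (\<pi> \<Otimes>\<^sub>M \<pi>) ((\<xi> \<Otimes>\<^sub>M ?N) \<Otimes>\<^sub>M (\<xi> \<Otimes>\<^sub>M ?N)) (\<lambda>(p, q). (F p, F q))"
      unfolding \<pi>'_def by (rule pair_measure_distr[OF F F])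
    moreover have "(\<lambda>(p, q). (F p, F q)) \<in> \<pi> \<Otimes>\<^sub>M \<pi> \<rightarrow>\<^sub>M (\<xi> \<Otimes>\<^sub>M ?N) \<Otimes>\<^sub>M (\<xi> \<Otimes>\<^sub>M ?N)"
      by measurable
    ultimately show ?thesis
      using c by (simp only: nn_integral_distr case_prod_unfold measurable_distr_eq1)
  qed
  also have "\<dots> \<le> (\<integral>\<^sup>+ (p, q). ennreal ((L * a p + L * a q)\<^sup>2) \<partial>(\<pi> \<Otimes>\<^sub>M \<pi>))"
  proof -
    have "c (F p, F q) \<le> ennreal ((L * a p + L * a q)\<^sup>2)" for p q
    proof -
      obtain x v where p: "p = (x, v)" by (cases p)
      obtain x' v' where q: "q = (x', v')" by (cases q)
      have "\<bar>\<phi> (dist x x') - G (T v) (T v')\<bar> \<le> L * a p + L * a q"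
        using lipschitz_dist_diff_le[OF lip, of x x' "y (T v)" "y (T v')"]
        by (simp add: p q G_def a_def distrib_left)
      then have "\<bar>\<phi> (dist x x') - G (T v) (T v')\<bar>\<^sup>2 \<le> (L * a p + L * a q)\<^sup>2"
        by (rule power_mono) simp
      then show ?thesis
        unfolding p q c_def F_def prod.case by (rule ennreal_leI)
    qed
    then show ?thesis
      by (intro nn_integral_mono) auto
  qed
  also have "\<dots> \<le> 4 * (\<integral>\<^sup>+ p. ennreal ((L * a p)\<^sup>2) \<partial>\<pi>)"
    by (intro nn_integral_pair_sum_square_le \<pi>.prob_space_axioms) measurable
  also have "\<dots> = 4 * (\<integral>\<^sup>+ p. ennreal (L\<^sup>2) * ennreal ((dist (fst p) (snd p))\<^sup>2) \<partial>\<pi>)"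
    using ae by (intro arg_cong[where f="\<lambda>z. 4 * z"] nn_integral_cong_AE)
      (auto simp: power_mult_distrib ennreal_mult)
  also have "\<dots> = ennreal ((2 * L)\<^sup>2) * (\<integral>\<^sup>+ (x, v). ennreal ((dist x v)\<^sup>2) \<partial>\<pi>)"
    by (subst nn_integral_cmult)
      (auto simp: power_mult_distrib ennreal_mult' case_prod_unfold mult.assoc)
  finally have cost: "ennreal_sqrt (\<integral>\<^sup>+ p. c p \<partial>(\<pi>' \<Otimes>\<^sub>M \<pi>'))
      \<le> ennreal (2 * L) * ennreal_sqrt (\<integral>\<^sup>+ (x, v). ennreal ((dist x v)\<^sup>2) \<partial>\<pi>)"
    using ennreal_sqrt_mono ennreal_sqrt_mult_square[of "2 * L"] L by (metis mult_nonneg_nonneg zero_le_numeral)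
  have "q_GW n (X, \<lambda>x x'. \<phi> (dist x x'), \<xi>)
      \<le> GW2 (X, \<lambda>x x'. \<phi> (dist x x'), \<xi>) (discrete_topology {1..n}, G, \<upsilon>')"
    unfolding q_GW_def using GM by (rule INF_lower)
  also have "\<dots> \<le> ennreal_sqrt (\<integral>\<^sup>+ p. c p \<partial>(\<pi>' \<Otimes>\<^sub>M \<pi>'))"
    unfolding GW2.simps c_def using \<pi>' by (rule INF_lower)
  also note cost
  finally show ?thesis using L by (simp add: ennreal_mult')
qed

theorem proposition4p1:
  fixes \<xi> :: "'a::polish_space measure"
    and g :: "'a \<Rightarrow> 'a \<Rightarrow> real"
    and \<phi> :: "real \<Rightarrow> real"
    and L :: real
    and n :: nat
  assumes "sets \<xi> = sets borel" and "prob_space \<xi>"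
    and "finite_second_moment \<xi>"
    and "gm_space (euclidean, g, \<xi>)"
    and "\<And>x x'. g x x' = \<phi> (dist x x')"
    and "n \<ge> 1"
    and "L-lipschitz_on (range (\<lambda>(x :: 'a, x' :: 'a). dist x x')) \<phi>"
  shows "q_GW n (euclidean, g, \<xi>) \<le> 2 * ennreal L * q_W n \<xi>"
proof -
  have g: "g = (\<lambda>x x'. \<phi> (dist x x'))"
    using assms(5) by (intro ext)
  have meas: "(\<lambda>(x, x'). \<phi> (dist x x')) \<in> borel_measurable (\<xi> \<Otimes>\<^sub>M \<xi>)"
    using assms(4) by (simp add: g)
  have fin: "2 * ennreal L \<noteq> \<top>"
    by (simp add: ennreal_mult_eq_top_iff)
  show ?thesis
    unfolding q_W_def
  proof (rule le_mult_INF_ennreal[OF finitely_supported_nonempty[OF assms(6)] fin])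
    fix \<upsilon> :: "'a measure"
    assume \<upsilon>: "\<upsilon> \<in> finitely_supported n"
    have "couplings \<xi> \<upsilon> \<noteq> {}"
      using pair_measure_in_couplings[OF assms(2)] finitely_supportedE[OF \<upsilon>] by blast
    then show "q_GW n (euclidean, g, \<xi>) \<le> 2 * ennreal L * W2 \<xi> \<upsilon>"
      unfolding W2_def g
      using q_GW_le_coupling_cost[OF assms(1,2) meas assms(6,7) \<upsilon>]
      by (intro le_mult_INF_ennreal fin)
  qed
qed

end
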